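(* Let $B\ge2$ be an integer and let $\alpha_\delta^{B,*}$ denote the optimal $\mathrm{CVaR}_\delta$-competitive ratio for discrete-time ski rental with buying cost $B$. Let $c=-\frac{1+2W_{-1}\left(-\frac{1}{2\sqrt{e}}\right)}{2}\approx1.25643$, where $W_{-1}$ is the $-1$ branch of the Lambert $W$ function. Then: (i) for all $\delta<1-\frac{c}{\log(B+1)}$, $\alpha_\delta^{B,*}<2-\frac{1}{B}$; (ii) for all $\delta\ge1-\frac{1}{2\lfloor\log_2B\rfloor+1}$ (with $\delta\le 1$), $\alpha_\delta^{B,*}=2-\frac1B$, and this optimum is attained by the deterministic strategy that purchases at time $B$.
   Context: Conditional value-at-risk (loss convention): for a real random variable $Y$ and $\delta\in[0,1)$, $\mathrm{CVaR}_\delta[Y]=\inf_{t\in\mathbb{R}}\{t+\frac{1}{1-\delta}\mathbb{E}[(Y-t)^+]\}=\frac{1}{1-\delta}\int_\delta^1F_Y^{-1}(p)\,dp$, and $\mathrm{CVaR}_1[Y]=\operatorname{ess\,sup}Y$. Discrete-time ski rental with integer buying cost $B\ge2$: a strategy is a probability distribution $\mu$ on $\mathbb{N}=\{1,2,\dots\}$ of the purchase day $X$; if the adversary chooses season length $s\in\mathbb{N}$, the cost is $s\cdot\mathbb{1}_{X>s}+(B+X-1)\cdot\mathbb{1}_{X\le s}$. Define $\alpha_\delta^{B,\mu}(s)=\mathrm{CVaR}_\delta[s\cdot\mathbb{1}_{X>s}+(B+X-1)\cdot\mathbb{1}_{X\le s}]/\min\{s,B\}$, $\alpha_\delta^{B,\mu}=\sup_{s\in\mathbb{N}}\alpha_\delta^{B,\mu}(s)$,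 and $\alpha_\delta^{B,*}=\inf_\mu\alpha_\delta^{B,\mu}$. *)

theory Defs
  imports "HOL-Probability.Probability"
begin

text \<open>
  The non-principal real branch of the Lambert W function: for \<open>- exp (- 1) \<le> x < 0\<close> there is a
  unique such \<open>w\<close>; outside this interval the value is unspecified.
\<close>
definition lambert_Wm1 :: "real \<Rightarrow> real" where
  "lambert_Wm1 x = (THE w. w \<le> - 1 \<and> w * exp w = x)"

text \<open>
  Conditional value-at-risk of a loss \<open>Y\<close> at level \<open>\<delta> \<in> [0, 1]\<close>. The expectation of the positive
  part is a nonnegative Lebesgue integral, so that it is \<open>\<infinity>\<close> (and not \<open>0\<close>) when \<open>Y\<close> has a
  nonintegrable upper tail.
\<close>
definition CVaR :: "'a measure \<Rightarrow> real \<Rightarrow> ('a \<Rightarrow> real) \<Rightarrow> ereal" where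
  "CVaR M \<delta> Y =
     (if \<delta> = 1 then esssup M (\<lambda>x. ereal (Y x))
      else (INF t::real. ereal t +
              ereal (1 / (1 - \<delta>)) * enn2ereal (\<integral>\<^sup>+ x. ennreal (max 0 (Y x - t)) \<partial>M)))"

text \<open>
  Days are numbered from 1: purchase days and season lengths range over the positive naturals.
  Skiing on the days before \<open>x\<close> costs \<open>x - 1\<close> in rent.
\<close>
definition ski_cost :: "nat \<Rightarrow> nat \<Rightarrow> nat \<Rightarrow> real" where
  "ski_cost B s x = (if x > s then real s else real B + real x - 1)"

definition strategies :: "nat pmf set" where
  "strategies = {\<mu>. set_pmf \<mu> \<subseteq> {1..}}"

definition cvar_ratio_at :: "nat \<Rightarrow> real \<Rightarrow> nat pmf \<Rightarrow> nat \<Rightarrow> ereal" where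
  "cvar_ratio_at B \<delta> \<mu> s = CVaR (measure_pmf \<mu>) \<delta> (ski_cost B s) / ereal (real (min s B))"

text \<open>The supremum is taken in the extended reals: it may be \<open>\<infinity>\<close>, e.g. if \<open>\<mu>\<close> has a heavy tail.\<close>
definition cvar_ratio :: "nat \<Rightarrow> real \<Rightarrow> nat pmf \<Rightarrow> ereal" where
  "cvar_ratio B \<delta> \<mu> = (SUP s\<in>{1..}. cvar_ratio_at B \<delta> \<mu> s)"

definition opt_cvar_ratio :: "nat \<Rightarrow> real \<Rightarrow> ereal" where
  "opt_cvar_ratio B \<delta> = (INF \<mu>\<in>strategies. cvar_ratio B \<delta> \<mu>)"

end

theory Submission imports Defs begin

text \<open>
  The definition of the Lambert constant says that \<open>exp c = 1 + 2 * c\<close> and \<open>c > 1\<close>, so that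
  \<open>exp a > 1 + 2 * a\<close> for \<open>a = (1 - \<delta>) * ln (B + 1) > c\<close>. Round up to whole days a random time with
  density proportional to \<open>1 / (B + 1 - v)\<close> on \<open>[0, B]\<close>. If the worst \<open>1 - \<delta>\<close> of the outcomes
  for season length \<open>s\<close> all buy by day \<open>s\<close>, then, with \<open>u = B + 1 - s\<close>, they come from the times \<open>v\<close>
  with \<open>u \<le> B + 1 - v \<le> exp a * u\<close>; there \<open>B + 1 - v\<close> has mean \<open>(exp a - 1) * u / a > 2 * u\<close>,
  which keeps the CVaR below \<open>2 * s - 1\<close>. Otherwise, for small \<open>s\<close>, the required inequality is
  convex in \<open>u\<close> and is checked at the two ends of its range.

  Conversely, the blocks of days \<open>x\<close> with \<open>2 ^ j \<le> B - x < 2 ^ (j + 1)\<close>, \<open>j \<le> k = \<lfloor>log 2 B\<rfloor>\<close>, and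
  the days from \<open>B\<close> on are \<open>k + 2 \<le> 2 * k + 1\<close> sets, so one of them has probability at least
  \<open>1 - \<delta>\<close>. The season length \<open>B - 2 ^ j\<close>, respectively \<open>2 * B - 1\<close>, makes the whole block cost at
  least \<open>2 - 1 / B\<close> times the optimum.
\<close>

section \<open>A logarithmic inequality and the constant c\<close>

text \<open>For \<open>b < a\<close> the gap between the two sides is the integral of (a - x) / x
  over b <= x <= a.\<close>

lemma diff_le_mult_ln:
  fixes a b :: real
  assumes "0 < a" "0 < b"
  shows "a - b \<le> a * ln (a / b)"
proof -
  have "ln (b / a) \<le> b / a - 1"
    using assms by (intro ln_le_minus_one) simp
  moreover have "ln (b / a) = - ln (a / b)"
    using assms by (simp add: ln_div)
  ultimately have "a * (1 - b / a) \<le> a * ln (a / b)"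
    using assms by (intro mult_left_mono) auto
  then show ?thesis
    using assms by (simp add: algebra_simps)
qed

lemma mult_exp_strict_antimono:
  fixes v w :: real
  assumes "v < w" "w \<le> - 1"
  shows "w * exp w < v * exp v"
proof (rule DERIV_neg_imp_decreasing_open[OF assms(1)])
  fix x assume x: "v < x" "x < w"
  have "((\<lambda>x. x * exp x) has_real_derivative (1 + x) * exp x) (at x)"
    by (auto intro!: derivative_eq_intros simp: algebra_simps)
  moreover have "(1 + x) * exp x < 0"
    using x assms by (intro mult_neg_pos) auto
  ultimately show "\<exists>y. ((\<lambda>x. x * exp x) has_real_derivative y) (at x) \<and> y < 0"
    by blast
qed (intro continuous_intros)

lemma lambert_Wm1_eqI:
  assumes "w \<le> - 1" "w * exp w = x"
  shows "lambert_Wm1 x = w"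
  unfolding lambert_Wm1_def
proof (rule the_equality)
  fix v assume "v \<le> - 1 \<and> v * exp v = x"
  then show "v = w"
    using assms mult_exp_strict_antimono[of v w] mult_exp_strict_antimono[of w v]
    by (cases v w rule: linorder_cases) auto
qed (use assms in simp)

text \<open>Putting w = - 1/2 - c turns w * exp w = - 1 / (2 * sqrt e) into exp c = 1 + 2 * c.
  Locating the root above 9/8 puts w below - 1, which excludes the root c = 0 of the principal
  branch.\<close>

lemma lambert_constant:
  fixes c :: real
  assumes c: "c = - (1 + 2 * lambert_Wm1 (- 1 / (2 * sqrt (exp 1)))) / 2"
  shows "exp c = 1 + 2 * c" "9 / 8 \<le> c"
proof -
  let ?f = "\<lambda>x::real. exp x - 1 - 2 * x"
  have "exp (9 / 8 :: real) = exp 1 * exp (1 / 8)"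
    by (simp flip: exp_add)
  also have "\<dots> \<le> (272 / 100) * (1 + 1 / 8 + (1 / 8)\<^sup>2)"
    using e_less_272 exp_bound[of "1 / 8"] by (intro mult_mono) auto
  finally have lo: "?f (9 / 8) \<le> 0"
    by (simp add: power2_eq_square)
  have "(1 + 1 / 2 + (1 / 2)\<^sup>2 / 2) ^ 3 \<le> exp (1 / 2 :: real) ^ 3"
    by (intro power_mono exp_lower_Taylor_quadratic) auto
  also have "\<dots> = exp (3 / 2 :: real)"
    by (simp flip: exp_of_nat_mult)
  finally have hi: "0 \<le> ?f (3 / 2)"
    by (simp add: power2_eq_square power3_eq_cube)
  have "\<exists>d\<ge>9 / 8. d \<le> 3 / 2 \<and> ?f d = 0"
    using lo hi by (intro IVT') (auto intro!: continuous_intros)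
  then obtain d :: real where d: "9 / 8 \<le> d" "?f d = 0"
    by blast
  have root: "sqrt (exp 1) = exp (1 / 2 :: real)"
    by (intro real_sqrt_unique) (auto simp: power2_eq_square simp flip: exp_add)
  have "exp (- (1 / 2) - d) = 1 / (exp (1 / 2) * (1 + 2 * d))"
    using d by (simp only: exp_diff exp_minus) (simp add: divide_simps)
  then have "(- (1 / 2) - d) * exp (- (1 / 2) - d) = - 1 / (2 * sqrt (exp 1))"
    using d unfolding root by (simp add: divide_simps) (simp add: algebra_simps)
  with d have "lambert_Wm1 (- 1 / (2 * sqrt (exp 1))) = - (1 / 2) - d"
    by (intro lambert_Wm1_eqI) auto
  with c have "c = d"
    by simp
  with d show "exp c = 1 + 2 * c" "9 / 8 \<le> c"
    by auto
qed

section \<open>Upper and lower bounds for the CVaR of a discrete distribution\<close>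

lemma CVaR_finite_support_le:
  assumes "finite A" "set_pmf \<mu> \<subseteq> A" "\<delta> < 1"
  shows "CVaR (measure_pmf \<mu>) \<delta> Y
    \<le> ereal (t + (\<Sum>x\<in>A. max 0 (Y x - t) * pmf \<mu> x) / (1 - \<delta>))"
proof -
  have "(\<integral>\<^sup>+ x. ennreal (max 0 (Y x - t)) \<partial>measure_pmf \<mu>)
      = (\<Sum>x\<in>A. ennreal (max 0 (Y x - t)) * ennreal (pmf \<mu> x))"
    using assms by (intro nn_integral_measure_pmf_support) auto
  also have "\<dots> = ennreal (\<Sum>x\<in>A. max 0 (Y x - t) * pmf \<mu> x)"
    by (simp add: ennreal_mult sum_nonneg flip: sum_ennreal)
  finally have "enn2ereal (\<integral>\<^sup>+ x. ennreal (max 0 (Y x - t)) \<partial>measure_pmf \<mu>)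
      = ereal (\<Sum>x\<in>A. max 0 (Y x - t) * pmf \<mu> x)"
    by (simp add: enn2ereal_ennreal sum_nonneg)
  moreover have "CVaR (measure_pmf \<mu>) \<delta> Y \<le> ereal t +
      ereal (1 / (1 - \<delta>)) * enn2ereal (\<integral>\<^sup>+ x. ennreal (max 0 (Y x - t)) \<partial>measure_pmf \<mu>)"
    using assms(3) unfolding CVaR_def by (auto intro: INF_lower)
  ultimately show ?thesis
    by simp
qed

text \<open>For every threshold t the mean excess over t is at least the probability of
  \<open>A\<close> times the positive part of a - t, hence at least (1 - \<delta>) * (a - t). At
  \<delta> = 1 the positive probability of \<open>A\<close> instead yields an atom with loss at
  least a.\<close>

lemma le_CVaR_pmf:
  fixes Y :: "'a \<Rightarrow> real"
  assumes "A \<subseteq> {x. a \<le> Y x}" "0 < measure (measure_pmf \<mu>) A"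
    "1 - \<delta> \<le> measure (measure_pmf \<mu>) A" "\<delta> \<le> 1"
  shows "ereal a \<le> CVaR (measure_pmf \<mu>) \<delta> Y"
proof (cases "\<delta> = 1")
  case True
  have "set_pmf \<mu> \<inter> A \<noteq> {}"
    using assms(2) by (auto simp: measure_pmf_zero_iff zero_less_measure_iff)
  then obtain x where x: "x \<in> set_pmf \<mu>" "a \<le> Y x"
    using assms(1) by auto
  have "AE x in measure_pmf \<mu>. ereal (Y x) \<le> esssup (measure_pmf \<mu>) (\<lambda>x. ereal (Y x))"
    by (rule esssup_AE)
  with x have "ereal (Y x) \<le> esssup (measure_pmf \<mu>) (\<lambda>x. ereal (Y x))"
    by (simp add: AE_measure_pmf_iff)
  with x(2) have "ereal a \<le> esssup (measure_pmf \<mu>) (\<lambda>x. ereal (Y x))"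
    using order_trans[of "ereal a" "ereal (Y x)"] by simp
  with True show ?thesis
    by (simp add: CVaR_def)
next
  case False
  with assms(4) have \<delta>: "0 < 1 - \<delta>"
    by simp
  let ?p = "measure (measure_pmf \<mu>) A"
  have "ereal a \<le> ereal t + ereal (1 / (1 - \<delta>)) *
      enn2ereal (\<integral>\<^sup>+ x. ennreal (max 0 (Y x - t)) \<partial>measure_pmf \<mu>)" (is "_ \<le> _ + _ * enn2ereal ?I") for t
  proof -
    have "ennreal (max 0 (a - t) * ?p) = ennreal (max 0 (a - t)) * emeasure (measure_pmf \<mu>) A"
      by (simp add: ennreal_mult measure_pmf.emeasure_eq_measure)
    also have "\<dots> = (\<integral>\<^sup>+ x. ennreal (max 0 (a - t)) * indicator A x \<partial>measure_pmf \<mu>)"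
      by (simp add: nn_integral_cmult_indicator)
    also have "\<dots> \<le> ?I"
      using assms(1) by (intro nn_integral_mono) (auto split: split_indicator intro!: ennreal_leI)
    finally have "ereal (max 0 (a - t) * ?p) \<le> enn2ereal ?I"
      by (simp add: less_eq_ennreal.rep_eq enn2ereal_ennreal)
    then have "ereal (1 / (1 - \<delta>)) * ereal (max 0 (a - t) * ?p)
        \<le> ereal (1 / (1 - \<delta>)) * enn2ereal ?I"
      using \<delta> by (intro ereal_mult_left_mono) auto
    moreover have "ereal (a - t) \<le> ereal (1 / (1 - \<delta>)) * ereal (max 0 (a - t) * ?p)"
    proof -
      have "(a - t) * (1 - \<delta>) \<le> max 0 (a - t) * (1 - \<delta>)"
        using \<delta> by (intro mult_right_mono) auto
      also have "\<dots> \<le> max 0 (a - t) * ?p"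
        using assms(3) by (intro mult_left_mono) auto
      finally show ?thesis
        using \<delta> by (simp add: pos_le_divide_eq)
    qed
    ultimately have "ereal (a - t) \<le> ereal (1 / (1 - \<delta>)) * enn2ereal ?I"
      by (rule order_trans[rotated])
    then have "ereal t + ereal (a - t) \<le> ereal t + ereal (1 / (1 - \<delta>)) * enn2ereal ?I"
      by (rule add_left_mono)
    then show ?thesis
      by simp
  qed
  with False show ?thesis
    unfolding CVaR_def by (auto intro: INF_greatest)
qed

lemma CVaR_return_pmf_le:
  assumes "\<delta> \<le> 1"
  shows "CVaR (measure_pmf (return_pmf x)) \<delta> Y \<le> ereal (Y x)"
proof (cases "\<delta> = 1")
  case True
  have "esssup (measure_pmf (return_pmf x)) (\<lambda>x. ereal (Y x)) \<le> ereal (Y x)"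
    by (intro esssup_I) (auto simp: AE_measure_pmf_iff)
  with True show ?thesis
    by (simp add: CVaR_def)
next
  case False
  with assms show ?thesis
    using CVaR_finite_support_le[of "{x}" "return_pmf x" \<delta> Y "Y x"] by simp
qed

subsection \<open>The logarithmic strategy\<close>

text \<open>The weight of day x is the integral of 1 / (n - v) over x - 1 <= v <= x, so the
  logarithms telescope.\<close>

lemma log_weights_sum:
  fixes n :: real
  assumes "real s < n"
  shows "(\<Sum>x=1..s. ln ((n + 1 - real x) / (n - real x))) = ln (n / (n - real s))"
  using assms
proof (induction s)
  case (Suc s)
  then show ?case
    by (simp add: ln_div)
qed simp

text \<open>
  For \<open>q < s\<close> the right-hand side is the integral of \<open>(v - q) / (n - v)\<close> over \<open>q \<le> v \<le> s\<close>.
\<close>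
lemma log_weights_excess_le:
  fixes n q :: real
  assumes "real s < n"
  shows "(\<Sum>x=1..s. max 0 (real x - 1 - q) * ln ((n + 1 - real x) / (n - real x)))
    \<le> (if real s \<le> q then 0 else (n - q) * ln ((n - q) / (n - real s)) - (real s - q))"
  using assms
proof (induction s)
  case (Suc s)
  let ?G = "\<lambda>v. if v \<le> q then 0 else (n - q) * ln ((n - q) / (n - v)) - (v - q)"
  let ?w = "ln ((n - real s) / (n - real s - 1))"
  have n: "real s + 1 < n"
    using Suc.prems by simp
  \<comment> \<open>The summand freezes v at the left end s of the interval from s to s + 1, so it
    is at most the increment of the integral. The cases place q beyond, inside or before this
    interval.\<close>
  have "max 0 (real s - q) * ?w + ?G (real s) \<le> ?G (real s + 1)"
  proof -
    consider "real s + 1 \<le> q" | "real s \<le> q" "q < real s + 1" | "q < real s"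
      by linarith
    then show ?thesis
    proof cases
      case 2
      then show ?thesis
        using n diff_le_mult_ln[of "n - q" "n - (real s + 1)"] by auto
    next
      case 3
      have "1 \<le> (n - real s) * ?w"
        using n diff_le_mult_ln[of "n - real s" "n - real s - 1"] by simp
      moreover have "ln ((n - q) / (n - (real s + 1))) = ln ((n - q) / (n - real s)) + ?w"
        using n 3 by (simp add: ln_div algebra_simps)
      ultimately show ?thesis
        using 3 by (simp add: algebra_simps)
    qed auto
  qed
  moreover have "(\<Sum>x=1..s. max 0 (real x - 1 - q) * ln ((n + 1 - real x) / (n - real x)))
      \<le> ?G (real s)"
    using Suc by simp
  moreover have "(\<Sum>x=1..Suc s. max 0 (real x - 1 - q) * ln ((n + 1 - real x) / (n - real x)))
      = (\<Sum>x=1..s. max 0 (real x - 1 - q) * ln ((n + 1 - real x) / (n - real x)))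
        + max 0 (real s - q) * ?w"
    by (simp add: algebra_simps)
  ultimately have "(\<Sum>x=1..Suc s. max 0 (real x - 1 - q) * ln ((n + 1 - real x) / (n - real x)))
      \<le> ?G (real s + 1)"
    by linarith
  then show ?case
    by (simp only: of_nat_Suc add.commute[of 1])
next
  case 0
  then show ?case
    using diff_le_mult_ln[of "n - q" n] by auto
qed

text \<open>Taking n = B + 1 keeps every denominator at least 1 up to day B and makes the weights
  add up to ln (B + 1), the logarithm in the bound on \<delta>.\<close>

lemma log_strategy_exists:
  assumes "1 \<le> B"
  obtains \<mu> :: "nat pmf" where "set_pmf \<mu> \<subseteq> {1..B}"
    "\<And>x. x \<in> {1..B} \<Longrightarrow>
      pmf \<mu> x = ln ((real B + 1 + 1 - real x) / (real B + 1 - real x)) / ln (real B + 1)"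
proof -
  let ?f = "\<lambda>x. if x \<in> {1..B}
    then ln ((real B + 1 + 1 - real x) / (real B + 1 - real x)) / ln (real B + 1) else 0"
  have nonneg: "0 \<le> ?f x" for x
    by auto
  have "(\<integral>\<^sup>+ x. ennreal (?f x) \<partial>count_space UNIV) = (\<Sum>x\<in>{1..B}. ennreal (?f x))"
    by (rule nn_integral_count_space') auto
  also have "\<dots> = ennreal (\<Sum>x\<in>{1..B}. ?f x)"
    by (rule sum_ennreal) (rule nonneg)
  also have "(\<Sum>x\<in>{1..B}. ?f x)
      = (\<Sum>x=1..B. ln ((real B + 1 + 1 - real x) / (real B + 1 - real x))) / ln (real B + 1)"
    by (simp add: sum_divide_distrib)
  also have "\<dots> = 1"
    using log_weights_sum[of B "real B + 1"] assms by simp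
  finally have total: "(\<integral>\<^sup>+ x. ennreal (?f x) \<partial>count_space UNIV) = 1"
    by simp
  show ?thesis
  proof (rule that[of "embed_pmf ?f"])
    show "set_pmf (embed_pmf ?f) \<subseteq> {1..B}"
      using set_embed_pmf[of ?f, OF nonneg total] by (auto split: if_splits)
    show "pmf (embed_pmf ?f) x
        = ln ((real B + 1 + 1 - real x) / (real B + 1 - real x)) / ln (real B + 1)"
      if "x \<in> {1..B}" for x
      using pmf_embed_pmf[of ?f, OF nonneg total, of x] that by simp
  qed
qed

text \<open>In the application u = b + 1 - s, and the left-hand side bounds ln (b + 1) times the
  mean excess of the cost over the threshold s. The lower bound on u says that buying by day s has
  probability at most 1 - \<delta>.\<close>

lemma log_strategy_early_bound:
  fixes a b u :: real
  assumes b: "3 \<le> b" and a: "9 / 8 < a" "2 * a < exp a - 1" "a \<le> ln (b + 1)"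
    and u: "(b + 1) * exp (- a) \<le> u" "u \<le> b"
  shows "(b + u) * ln ((b + 1) / u) - (b + 1 - u) < a * (b + 1 - u) * (1 - 1 / b)"
proof -
  \<comment> \<open>\<open>K u\<close> is the left-hand side minus the right-hand side. Its second
    derivative is nonnegative up to b, so the two ends decide.\<close>
  define K where "K v = (b + v) * (ln (b + 1) - ln v) - (b + 1 - v) * (1 + a * (1 - 1 / b))" for v
  define u0 where "u0 = (b + 1) * exp (- a)"
  have u0: "0 < u0"
    using b by (simp add: u0_def)
  have "convex_on {u0..b} K"
  proof (rule f''_ge0_imp_convex)
    fix v assume "v \<in> {u0..b}"
    then have v: "0 < v" "v \<le> b"
      using u0 by auto
    have "(K has_real_derivative
        (ln (b + 1) - ln v) - (b + v) / v + (1 + a * (1 - 1 / b))) (at v)"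
      unfolding K_def using v(1) by (auto intro!: derivative_eq_intros)
    moreover have "(b + v) / v = b / v + 1"
      using v(1) by (simp add: add_divide_distrib)
    ultimately show "(K has_real_derivative (ln (b + 1) - ln v - b / v + a * (1 - 1 / b))) (at v)"
      by (simp add: algebra_simps)
    show "((\<lambda>v. ln (b + 1) - ln v - b / v + a * (1 - 1 / b))
        has_real_derivative (b - v) / v\<^sup>2) (at v)"
      using v(1) by (auto intro!: derivative_eq_intros simp: power2_eq_square diff_divide_distrib)
    show "0 \<le> (b - v) / v\<^sup>2"
      using v by simp
  qed simp
  then have "K u \<le> max (K u0) (K b)"
    using u by (intro convex_on_le_max) (auto simp: u0_def)
  \<comment> \<open>At this end the logarithm equals a, and s = (exp a - 1) * u0 exceeds 2 * a * u0;
    the remaining terms a * s / b - a are at most 0.\<close>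
  moreover have "K u0 < 0"
  proof -
    define s where "s = b + 1 - u0"
    have e: "b + 1 = u0 * exp a"
      by (simp add: u0_def exp_minus field_simps)
    have "exp a \<le> b + 1"
      using a(3) b by (subst (asm) ln_ge_iff) auto
    then have "1 \<le> u0"
      by (simp add: u0_def exp_minus field_simps)
    then have "s / b \<le> 1"
      using b by (simp add: s_def)
    then have "a * (s / b) \<le> a * 1"
      using a by (intro mult_left_mono) auto
    moreover have "u0 * (2 * a) < u0 * (exp a - 1)"
      using a(2) u0 by simp
    then have "u0 * (2 * a) < s"
      unfolding s_def e by (simp add: algebra_simps)
    moreover have "ln (b + 1) - ln u0 = a"
      using u0 by (simp add: e ln_mult)
    moreover have "a * (b + u0) = a * s + u0 * (2 * a) - a"
      by (simp add: s_def algebra_simps)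
    ultimately show ?thesis
      unfolding K_def s_def[symmetric] by (simp add: algebra_simps)
  qed
  moreover have "K b < 0"
  proof -
    \<comment> \<open>This end is s = 1. The trapezoidal rule overestimates the integral of the
      convex function 1 / x from b to b + 1.\<close>
    have "ln (b + 1) - ln b \<le> 1 * (inverse b + inverse (b + 1)) / 2"
      using b by (intro ln_inverse_approx_le) auto
    then have "2 * b * (ln (b + 1) - ln b) \<le> 2 * b * ((inverse b + inverse (b + 1)) / 2)"
      using b by (intro mult_left_mono) auto
    also have "\<dots> = b * inverse b + b * inverse (b + 1)"
      by (simp add: algebra_simps)
    also have "\<dots> = 1 + b / (b + 1)"
      using b by (simp add: divide_inverse)
    finally have 1: "2 * b * (ln (b + 1) - ln b) - 1 \<le> b / (b + 1)"
      by simp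
    have "3 * 3 \<le> b * b"
      using b by (intro mult_mono) auto
    \<comment> \<open>Equality holds at b = 3, so 9/8 is the least constant that serves all b >=
      3.\<close>
    then have "b / (b + 1) \<le> 9 / 8 * (1 - 1 / b)"
      using b by (simp add: field_simps)
    also have "\<dots> < a * (1 - 1 / b)"
      using a b by (intro mult_strict_right_mono) auto
    finally show ?thesis
      using 1 by (simp add: K_def)
  qed
  ultimately have "K u < 0"
    by simp
  moreover have "ln ((b + 1) / u) = ln (b + 1) - ln u"
    using u u0 b by (simp add: ln_div u0_def[symmetric])
  moreover have "(b + 1 - u) * (1 + a * (1 - 1 / b))
      = (b + 1 - u) + a * (b + 1 - u) * (1 - 1 / b)"
    by (simp only: distrib_left mult_1_right mult.assoc mult.left_commute[of a])
  ultimately show ?thesis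
    unfolding K_def by simp
qed


lemma log_strategy_cost:
  fixes a \<delta> :: real
  assumes B: "3 \<le> B" and s: "1 \<le> s" "s \<le> B" and \<delta>: "0 \<le> \<delta>" "\<delta> < 1"
    and a: "a = (1 - \<delta>) * ln (real B + 1)" "9 / 8 < a" "2 * a < exp a - 1"
    and p: "\<And>x. x \<in> {1..B} \<Longrightarrow>
      p x = ln ((real B + 1 + 1 - real x) / (real B + 1 - real x)) / ln (real B + 1)"
  shows "\<exists>t. t + (\<Sum>x=1..B. max 0 (ski_cost B s x - t) * p x) / (1 - \<delta>)
    < (2 - 1 / real B) * real s"
proof -
  define n where "n = real B + 1"
  define u where "u = n - real s"
  define w where "w x = ln ((n + 1 - real x) / (n - real x))" for x :: nat
  have u: "1 \<le> u" "u \<le> real B" "real s < n"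
    using s by (auto simp: u_def n_def)
  \<comment> \<open>With a threshold of at least s, only days x <= s can contribute excess; the
    factors 1 / ln n and 1 / (1 - \<delta>) combine to 1 / a.\<close>
  have expand: "t + (\<Sum>x=1..B. max 0 (ski_cost B s x - t) * p x) / (1 - \<delta>)
      = t + (\<Sum>x=1..s. max 0 (real x - 1 - (t - real B)) * w x) / a" if "real s \<le> t" for t
  proof -
    have "(\<Sum>x=1..B. max 0 (ski_cost B s x - t) * p x)
        = (\<Sum>x=1..s. max 0 (real x - 1 - (t - real B)) * w x / ln n)"
      using s that p
      by (intro sum.mono_neutral_cong_right)
         (auto simp: ski_cost_def w_def n_def algebra_simps)
    also have "\<dots> = (\<Sum>x=1..s. max 0 (real x - 1 - (t - real B)) * w x) / ln n"
      by (simp add: sum_divide_distrib)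
    finally show ?thesis
      by (simp add: a(1) n_def mult.commute)
  qed
  show ?thesis
  proof (cases "n * exp (- a) \<le> u")
    case True
    \<comment> \<open>At threshold s the excess is (B - s) + (x - 1): a constant part and the excess
      sum for q = 0.\<close>
    have "(\<Sum>x=1..s. max 0 (real x - 1 - (real s - real B)) * w x)
        = (\<Sum>x=1..s. (real B - real s) * w x + max 0 (real x - 1 - 0) * w x)"
      using s by (intro sum.cong) (auto simp: algebra_simps)
    also have "\<dots> = (real B - real s) * ln (n / u) + (\<Sum>x=1..s. max 0 (real x - 1 - 0) * w x)"
      using log_weights_sum[of s n] u
      by (simp add: sum.distrib w_def u_def flip: sum_distrib_left)
    also have "\<dots> \<le> (real B - real s) * ln (n / u) + (n * ln (n / u) - real s)"
      using log_weights_excess_le[of s n 0] u s by (simp add: w_def u_def)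
    also have "\<dots> = (real B + u) * ln (n / u) - real s"
      by (simp add: u_def algebra_simps)
    also have "\<dots> < a * real s * (1 - 1 / real B)"
    proof -
      have "a \<le> 1 * ln (real B + 1)"
        unfolding a(1) using \<delta> by (intro mult_right_mono) auto
      with log_strategy_early_bound[of "real B" a u] show ?thesis
        using True u B a by (simp add: n_def u_def)
    qed
    finally have "(\<Sum>x=1..s. max 0 (real x - 1 - (real s - real B)) * w x) / a
        < real s * (1 - 1 / real B)"
      using a(2) by (simp add: divide_less_eq mult_ac)
    moreover have "real s + real s * (1 - 1 / real B) = (2 - 1 / real B) * real s"
      by (simp add: algebra_simps)
    ultimately have lt: "real s + (\<Sum>x=1..s. max 0 (real x - 1 - (real s - real B)) * w x) / a
        < (2 - 1 / real B) * real s"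
      by linarith
    show ?thesis
      by (rule exI[of _ "real s"]) (subst expand[OF order_refl], rule lt)
  next
    case False
    \<comment> \<open>The times from q to s carry weight ln ((n - q) / u) = a, that is, probability
      1 - \<delta>. Hence B + q is the \<delta>-quantile of the cost before rounding to
      days.\<close>
    define q where "q = n - exp a * u"
    have "exp a * u < exp a * (n * exp (- a))"
      using False by simp
    then have "0 < q"
      by (simp add: q_def exp_minus field_simps)
    have gap: "2 * a * u < real s - q"
      using mult_strict_right_mono[OF a(3), of u] u by (simp add: q_def u_def algebra_simps)
    then have "q < real s"
      using a(2) u mult_pos_pos[of "2 * a" u] by linarith
    have "(\<Sum>x=1..s. max 0 (real x - 1 - (real B + q - real B)) * w x)
        \<le> (n - q) * ln ((n - q) / u) - (real s - q)"
      using log_weights_excess_le[of s n q] u \<open>q < real s\<close> by (simp add: w_def u_def)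
    also have "\<dots> = (n - q) * a - (real s - q)"
      using u by (simp add: q_def)
    finally have "(\<Sum>x=1..s. max 0 (real x - 1 - (real B + q - real B)) * w x) / a
        \<le> ((n - q) * a - (real s - q)) / a"
      using a(2) by (intro divide_right_mono) auto
    also have "\<dots> = (n - q) - (real s - q) / a"
      using a(2) by (simp add: diff_divide_distrib)
    also have "\<dots> < (n - q) - 2 * u"
      using gap a(2) by (simp add: less_divide_eq mult_ac)
    finally have "real B + q + (\<Sum>x=1..s. max 0 (real x - 1 - (real B + q - real B)) * w x) / a
        < 2 * real s - 1"
      by (simp add: u_def n_def)
    also have "\<dots> \<le> (2 - 1 / real B) * real s"
      using s B by (simp add: field_simps)
    finally have lt: "real B + q + (\<Sum>x=1..s. max 0 (real x - 1 - (real B + q - real B)) * w x) / a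
        < (2 - 1 / real B) * real s" .
    have "real s \<le> real B + q"
      using s \<open>0 < q\<close> by simp
    from expand[OF this] lt show ?thesis
      by (intro exI[of _ "real B + q"]) (simp only:)
  qed
qed

section \<open>From CVaR bounds to competitive ratios\<close>

lemma cvar_ratio_at_le:
  assumes "1 \<le> B" "1 \<le> s" "CVaR (measure_pmf \<mu>) \<delta> (ski_cost B s) \<le> ereal (r * real (min s B))"
  shows "cvar_ratio_at B \<delta> \<mu> s \<le> ereal r"
  using assms unfolding cvar_ratio_at_def by (subst ereal_divide_le_pos) (auto simp: mult.commute)

lemma cvar_ratio_at_ge:
  assumes "1 \<le> B" "1 \<le> s" "ereal (r * real (min s B)) \<le> CVaR (measure_pmf \<mu>) \<delta> (ski_cost B s)"
  shows "ereal r \<le> cvar_ratio_at B \<delta> \<mu> s"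
  using assms unfolding cvar_ratio_at_def by (subst ereal_le_divide_pos) (auto simp: mult.commute)

text \<open>Strictness has to survive the supremum over all seasons. Since the strategy buys by day
  B, seasons longer than B cost the same as season B, so a maximum of finitely many strict bounds
  suffices.\<close>

lemma opt_cvar_ratio_less:
  fixes a \<delta> :: real
  assumes B: "3 \<le> B" and \<delta>: "0 \<le> \<delta>" "\<delta> < 1"
    and a: "a = (1 - \<delta>) * ln (real B + 1)" "9 / 8 < a" "2 * a < exp a - 1"
  shows "opt_cvar_ratio B \<delta> < ereal (2 - 1 / real B)"
proof -
  obtain \<mu> where \<mu>: "set_pmf \<mu> \<subseteq> {1..B}" and p: "\<And>x. x \<in> {1..B} \<Longrightarrow>
      pmf \<mu> x = ln ((real B + 1 + 1 - real x) / (real B + 1 - real x)) / ln (real B + 1)"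
    using log_strategy_exists[of B] B by auto
  have "\<forall>m\<in>{1..B}. \<exists>t. t + (\<Sum>x=1..B. max 0 (ski_cost B m x - t) * pmf \<mu> x) / (1 - \<delta>)
      < (2 - 1 / real B) * real m"
    using log_strategy_cost[OF B _ _ \<delta> a p] by auto
  then obtain t where t: "\<And>m. m \<in> {1..B} \<Longrightarrow>
      t m + (\<Sum>x=1..B. max 0 (ski_cost B m x - t m) * pmf \<mu> x) / (1 - \<delta>)
      < (2 - 1 / real B) * real m"
    by (auto simp: Bex_def Ball_def dest!: choice_iff'[THEN iffD1])
  define r where "r m = (t m +
      (\<Sum>x=1..B. max 0 (ski_cost B m x - t m) * pmf \<mu> x) / (1 - \<delta>)) / real m" for m
  have "cvar_ratio_at B \<delta> \<mu> s \<le> ereal (Max (r ` {1..B}))" if s: "1 \<le> s" for s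
  proof -
    define m where "m = min s B"
    have m: "m \<in> {1..B}"
      using s B by (auto simp: m_def)
    have "(\<Sum>x=1..B. max 0 (ski_cost B s x - t m) * pmf \<mu> x)
        = (\<Sum>x=1..B. max 0 (ski_cost B m x - t m) * pmf \<mu> x)"
      by (intro sum.cong) (auto simp: ski_cost_def m_def)
    then have "CVaR (measure_pmf \<mu>) \<delta> (ski_cost B s) \<le> ereal (r m * real m)"
      using CVaR_finite_support_le[of "{1..B}" \<mu> \<delta> "ski_cost B s" "t m"] \<mu> \<delta> m
      by (simp add: r_def)
    also have "\<dots> \<le> ereal (Max (r ` {1..B}) * real m)"
      using m by (auto intro!: mult_right_mono Max_ge)
    finally show ?thesis
      using s B by (intro cvar_ratio_at_le) (auto simp: m_def)
  qed
  then have "cvar_ratio B \<delta> \<mu> \<le> ereal (Max (r ` {1..B}))"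
    unfolding cvar_ratio_def by (auto intro: SUP_least)
  also have "\<dots> < ereal (2 - 1 / real B)"
    using t B by (auto simp: r_def divide_less_eq)
  finally have "cvar_ratio B \<delta> \<mu> < ereal (2 - 1 / real B)" .
  moreover have "\<mu> \<in> strategies"
    using \<mu> by (auto simp: strategies_def)
  ultimately show ?thesis
    unfolding opt_cvar_ratio_def by (auto simp: INF_less_iff)
qed

subsection \<open>Optimality of buying on day B\<close>

lemma cvar_ratio_ge:
  assumes B: "1 \<le> B" "B < 2 ^ (k + 1)" and \<delta>: "1 - \<delta> \<le> 1 / (real k + 2)" "\<delta> \<le> 1"
    and \<mu>: "\<mu> \<in> strategies"
  shows "ereal (2 - 1 / real B) \<le> cvar_ratio B \<delta> \<mu>"
proof -
  define A where "A j = (if j \<le> k then {x. x < B \<and> 2 ^ j \<le> B - x \<and> B - x < 2 ^ (j + 1)} else {B..})"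
    for j :: nat
  have cover: "(\<Union>j\<in>{..k + 1}. A j) = UNIV"
  proof -
    have "\<exists>j\<le>k + 1. x \<in> A j" for x
    proof (cases "x < B")
      case True
      then have "1 \<le> B - x"
        by simp
      then obtain j where j: "2 ^ j \<le> B - x" "B - x < 2 ^ (j + 1)"
        using ex_power_ivl1[of 2 "B - x"] by blast
      then have "(2::nat) ^ j < 2 ^ (k + 1)"
        using B by linarith
      then have "j < k + 1"
        by (simp only: power_strict_increasing_iff)
      with j True show ?thesis
        by (auto simp: A_def intro!: exI[of _ j])
    next
      case False
      then show ?thesis
        by (auto simp: A_def intro!: exI[of _ "k + 1"])
    qed
    then show ?thesis
      by auto
  qed
  obtain j where j: "j \<le> k + 1" "1 / (real k + 2) \<le> measure (measure_pmf \<mu>) (A j)"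
  proof (rule ccontr)
    assume "\<not> thesis"
    with that have small: "measure (measure_pmf \<mu>) (A j) < 1 / (real k + 2)" if "j \<le> k + 1" for j
      using \<open>j \<le> k + 1\<close> by (meson not_le)
    have "measure (measure_pmf \<mu>) (\<Union>j\<in>{..k + 1}. A j)
        \<le> (\<Sum>j\<le>k + 1. measure (measure_pmf \<mu>) (A j))"
      by (rule measure_pmf.finite_measure_subadditive_finite) auto
    also have "\<dots> < (\<Sum>j\<le>k + 1. 1 / (real k + 2))"
      using small by (intro sum_strict_mono) auto
    also have "\<dots> = 1"
      by (simp add: field_simps)
    finally show False
      unfolding cover by simp
  qed
  then have mass: "0 < measure (measure_pmf \<mu>) (A j)" "1 - \<delta> \<le> measure (measure_pmf \<mu>) (A j)"
    using \<delta> by (auto intro: less_le_trans[rotated])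
  have at: "ereal (2 - 1 / real B) \<le> cvar_ratio_at B \<delta> \<mu> s"
    if "1 \<le> s" "A j \<subseteq> {x. (2 - 1 / real B) * real (min s B) \<le> ski_cost B s x}" for s
    using that B(1) mass \<delta>(2) by (intro cvar_ratio_at_ge le_CVaR_pmf[of "A j"]) auto
  have "\<exists>s\<ge>1. ereal (2 - 1 / real B) \<le> cvar_ratio_at B \<delta> \<mu> s"
  proof (cases "j \<le> k")
    case True
    \<comment> \<open>A purchase day y >= 1 in the block ensures 2 ^ j < B, so that B - 2 ^ j is a
      valid season length. The block {0}, which occurs when B is a power of 2, is ruled out
      here.\<close>
    have "set_pmf \<mu> \<inter> A j \<noteq> {}"
      using mass(1) by (auto simp: measure_pmf_zero_iff zero_less_measure_iff)
    then obtain y where "1 \<le> y" "2 ^ j \<le> B - y"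
      using \<mu> True by (auto simp: A_def strategies_def)
    define s where "s = B - 2 ^ j"
    have pow: "(2::nat) ^ j < B"
      using \<open>1 \<le> y\<close> \<open>2 ^ j \<le> B - y\<close> zero_less_power[of "2::nat" j] by linarith
    then have s: "1 \<le> s" "s \<le> B" "real s = real B - 2 ^ j"
      by (auto simp: s_def of_nat_diff)
    show ?thesis
    proof (intro exI[of _ s] conjI at subsetI CollectI)
      fix x assume "x \<in> A j"
      with True have x: "x < B" "2 ^ j \<le> B - x" "B - x < 2 * 2 ^ j"
        by (auto simp: A_def)
      then have "x \<le> s"
        by (auto simp: s_def)
      \<comment> \<open>The strict upper end of the block supplies the 1 that makes B + x - 1 at
        least 2 * (B - 2 ^ j).\<close>
      have "B + 1 \<le> x + 2 * 2 ^ j"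
        using x by linarith
      then have "real (B + 1) \<le> real (x + 2 * 2 ^ j)"
        by (simp only: of_nat_le_iff)
      then have "2 * real s \<le> ski_cost B s x"
        using \<open>x \<le> s\<close> s(3) by (simp add: ski_cost_def)
      moreover have "(2 - 1 / real B) * real (min s B) \<le> 2 * real s"
        using s(2) by (intro mult_mono) auto
      ultimately show "(2 - 1 / real B) * real (min s B) \<le> ski_cost B s x"
        by linarith
    qed (use s in auto)
  next
    case False
    show ?thesis
    \<comment> \<open>Renting throughout this season costs exactly 2 * B - 1, and buying on or after
      day B costs at least as much.\<close>
    proof (intro exI[of _ "2 * B - 1"] conjI at subsetI CollectI)
      fix x assume "x \<in> A j"
      then have "B \<le> x"
        using False by (simp add: A_def)
      moreover have "min (2 * B - 1) B = B"
        using B(1) by simp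
      moreover have "real (2 * B - 1) = 2 * real B - 1"
        using B(1) by (simp add: of_nat_diff)
      moreover have "(2 - 1 / real B) * real B = 2 * real B - 1"
        using B(1) by (simp add: field_simps)
      ultimately show "(2 - 1 / real B) * real (min (2 * B - 1) B) \<le> ski_cost B (2 * B - 1) x"
        by (simp add: ski_cost_def)
    qed (use B in auto)
  qed
  then show ?thesis
    unfolding cvar_ratio_def by (auto intro: SUP_upper2)
qed


lemma cvar_ratio_buy_on_day_B_le:
  assumes B: "1 \<le> B" and \<delta>: "\<delta> \<le> 1"
  shows "cvar_ratio B \<delta> (return_pmf B) \<le> ereal (2 - 1 / real B)"
proof -
  have "cvar_ratio_at B \<delta> (return_pmf B) s \<le> ereal (2 - 1 / real B)" if s: "1 \<le> s" for s
  proof (rule cvar_ratio_at_le[OF B s])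
    have "ski_cost B s B \<le> (2 - 1 / real B) * real (min s B)"
    proof (cases "s < B")
      case True
      have "1 * real s \<le> (2 - 1 / real B) * real s"
        using B by (intro mult_right_mono) auto
      with True show ?thesis
        by (simp add: ski_cost_def)
    next
      case False
      then have "min s B = B"
        by simp
      moreover have "(2 - 1 / real B) * real B = 2 * real B - 1"
        using B by (simp add: field_simps)
      ultimately show ?thesis
        using False by (simp add: ski_cost_def)
    qed
    then show "CVaR (measure_pmf (return_pmf B)) \<delta> (ski_cost B s)
        \<le> ereal ((2 - 1 / real B) * real (min s B))"
      using order_trans[OF CVaR_return_pmf_le[OF \<delta>, of B "ski_cost B s"]] by simp
  qed
  then show ?thesis
    unfolding cvar_ratio_def by (auto intro: SUP_least)
qed

theorem theorem4:
  fixes B :: nat and c :: real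
  assumes "B \<ge> 2"
    and "c = - (1 + 2 * lambert_Wm1 (- 1 / (2 * sqrt (exp 1)))) / 2"
  shows "(\<forall>\<delta>::real. 0 \<le> \<delta> \<and> \<delta> < 1 - c / ln (real B + 1) \<longrightarrow>
            opt_cvar_ratio B \<delta> < ereal (2 - 1 / real B)) \<and>
         (\<forall>\<delta>::real. 1 - 1 / (2 * real_of_int \<lfloor>log 2 (real B)\<rfloor> + 1) \<le> \<delta> \<and> \<delta> \<le> 1 \<longrightarrow>
            opt_cvar_ratio B \<delta> = ereal (2 - 1 / real B) \<and>
            cvar_ratio B \<delta> (return_pmf B) = opt_cvar_ratio B \<delta>)"
proof (intro conjI allI impI; elim conjE)
  note c = lambert_constant[OF assms(2)]
  fix \<delta> :: real
  assume \<delta>: "0 \<le> \<delta>" "\<delta> < 1 - c / ln (real B + 1)"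
  define a where "a = (1 - \<delta>) * ln (real B + 1)"
  have L: "0 < ln (real B + 1)"
    using assms(1) by simp
  have "c / ln (real B + 1) < 1 - \<delta>"
    using \<delta> by simp
  then have "c < a"
    using L by (simp add: a_def pos_divide_less_eq)
  have "0 < c / ln (real B + 1)"
    using c L by simp
  then have "\<delta> < 1"
    using \<delta> by simp
  have "a \<le> 1 * ln (real B + 1)"
    unfolding a_def using \<delta> L by (intro mult_right_mono) auto
  \<comment> \<open>From 1 + 2 * c = exp c < B + 1 and c >= 9/8 follows B > 9/4; for B = 2 no
    \<delta> >= 0 satisfies the bound.\<close>
  with \<open>c < a\<close> have "exp c < exp (ln (real B + 1))"
    by (simp only: exp_less_cancel_iff)
  then have "3 \<le> B"
    using c by simp
  \<comment> \<open>The tangent bound for exp at 0 carries the equation at c to the strict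
    inequality exp a > 1 + 2 * a beyond c.\<close>
  have "(1 + 2 * c) * (1 + (a - c)) \<le> exp c * exp (a - c)"
    using c \<open>c < a\<close> exp_ge_add_one_self[of "a - c"] by (intro mult_mono) auto
  also have "\<dots> = exp a"
    by (simp flip: exp_add)
  finally have "(1 + 2 * c) * (1 + (a - c)) \<le> exp a" .
  moreover have "2 * (a - c) < (1 + 2 * c) * (a - c)"
    using c(2) \<open>c < a\<close> by (intro mult_strict_right_mono) auto
  ultimately have "2 * a < exp a - 1"
    by (simp add: algebra_simps)
  then show "opt_cvar_ratio B \<delta> < ereal (2 - 1 / real B)"
    using opt_cvar_ratio_less[OF \<open>3 \<le> B\<close> \<delta>(1) \<open>\<delta> < 1\<close> a_def] c(2) \<open>c < a\<close> by simp
next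
  fix \<delta> :: real
  assume \<delta>: "1 - 1 / (2 * real_of_int \<lfloor>log 2 (real B)\<rfloor> + 1) \<le> \<delta>" "\<delta> \<le> 1"
  define k where "k = nat \<lfloor>log 2 (real B)\<rfloor>"
  have "1 \<le> \<lfloor>log 2 (real B)\<rfloor>"
    using assms(1) by (simp add: le_log_iff)
  then have k: "1 \<le> k" "real_of_int \<lfloor>log 2 (real B)\<rfloor> = real k"
    unfolding k_def by linarith+
  have "log 2 (real B) < real k + 1"
    using k(2) by linarith
  then have "real B < 2 powr real (k + 1)"
    using assms(1) by (simp add: log_less_iff add.commute)
  then have "real B < real (2 ^ (k + 1))"
    by (simp only: powr_realpow of_nat_power of_nat_numeral zero_less_numeral)
  then have B: "B < 2 ^ (k + 1)"
    by (simp only: of_nat_less_iff)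
  \<comment> \<open>As k >= 1, there are k + 2 <= 2 * k + 1 blocks for the pigeonhole
    argument.\<close>
  have "1 / (2 * real k + 1) \<le> 1 / (real k + 2)"
    using k(1) by (intro divide_left_mono) auto
  then have "1 - \<delta> \<le> 1 / (real k + 2)"
    using \<delta>(1) k(2) by simp
  then have lower: "ereal (2 - 1 / real B) \<le> cvar_ratio B \<delta> \<mu>" if "\<mu> \<in> strategies" for \<mu>
    using cvar_ratio_ge[OF _ B _ \<delta>(2) that] assms(1) by simp
  have mem: "return_pmf B \<in> strategies"
    using assms(1) by (simp add: strategies_def)
  have upper: "cvar_ratio B \<delta> (return_pmf B) \<le> ereal (2 - 1 / real B)"
    using assms(1) \<delta>(2) by (intro cvar_ratio_buy_on_day_B_le) auto
  show opt: "opt_cvar_ratio B \<delta> = ereal (2 - 1 / real B)"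
  proof (rule antisym)
    show "opt_cvar_ratio B \<delta> \<le> ereal (2 - 1 / real B)"
      unfolding opt_cvar_ratio_def using mem upper by (rule INF_lower2)
    show "ereal (2 - 1 / real B) \<le> opt_cvar_ratio B \<delta>"
      unfolding opt_cvar_ratio_def by (rule INF_greatest[OF lower])
  qed
  show "cvar_ratio B \<delta> (return_pmf B) = opt_cvar_ratio B \<delta>"
    unfolding opt using lower[OF mem] upper by (rule antisym[rotated])
qed

end
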